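(* Let $K$ be a field, $S_1,\dots,S_n\subseteq \mathrm{S}_{\mathrm{val}}(K)$, $t\in K^\times$, and $z_1,\dots,z_n\in K^\times$. Assume: (U) the uniformity assumption (defined in the context) holds for $S=S_1\cup\dots\cup S_n$ and $t$; (T) each $S_i$ is compact in $\mathcal{T}_{\mathrm{Zar}^*}$; (I) the $S_i$ are pairwise $t$-independent and pairwise incomparable. Then there exists $z\in K^\times$ with $$v(z)=v(z_i)\quad\text{for all } v\in S_i,\ \text{for } i=1,\dots,n,$$ if and only if for any $i,j$ and any valuation $w$ on $K$ with a refinement in $S_i$ and a refinement in $S_j$ we have $w(z_i)=w(z_j)$.
   Context: $\mathrm{S}_{\mathrm{val}}(K)$ is the set of equivalence classes of Krull valuations on $K$ (written additively, trivial one included). $\mathcal{O}_v=\{x\in K: v(x)\ge0\}$, $\mathfrak{m}_v=\{x\in K: v(x)>0\}$, $\mathcal{O}_v^\times=\mathcal{O}_v\setminus\mathfrak{m}_v$. The topology $\mathcal{T}_{\mathrm{Zar}^*}$ on $\mathrm{S}_{\mathrm{val}}(K)$ has open subbasis $\{v: v(x)>0\}$, $x\in K$; compact means quasi-compact. If $\mathcal{O}_v\subseteq\mathcal{O}_w$, then $v$ is a refinement of $w$ and $w$ a coarsening of $v$ (equality allowed); incomparable means neither refines the other; $v\vee w$ is the finest common coarsening of $v$ and $w$. Valuations $v,w$ are $t$-independent if $t\in\mathcal{O}_{v\vee w}^\times$. Two sets of valuations are incomparable (resp. $t$-independent) if every element of the first is incomparable (resp. $t$-independent) to every element of the second. Uniformity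 assumption for $S$ and $t\in K^\times$: there exists $f\in K[X]$ of degree $d\ge2$ with leading coefficient $a_d$ such that for all $v\in S$: (i) for any $x\in\mathcal{O}_v$, $f(x)\in\mathcal{O}_v$; (ii) for any $x\in\mathcal{O}_v$, $f(x)\notin t\mathfrak{m}_v$; (iii) for any $x\in K\setminus\mathcal{O}_v$, $f(x)\in x^d(\mathcal{O}_v\setminus t\mathfrak{m}_v)\cap(a_dx^d+x^{d-1}\mathcal{O}_v)$; (iv) $\mathcal{O}_v+\mathcal{O}_v\subseteq t^{-1}\mathcal{O}_v$. *)

theory Defs
  imports
    "HOL-Analysis.Analysis"
    "HOL-Computational_Algebra.Polynomial"
    "HOL-Algebra.Group"
begin

section \<open>Krull valuations\<close>

text \<open>
  Value groups of Krull valuations vary with the valuation, so they are ordered abelian groups on a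
  carrier rather than instances of a type class. They are written additively in the mathematics but
  multiplicatively here, following \<^theory>\<open>HOL-Algebra.Group\<close>; in particular the value \<open>0\<close> is
  \<open>\<one>\<^bsub>G\<^esub>\<close>. The pair \<open>(g, h) \<in> r\<close> means \<open>g \<le> h\<close>, and \<^const>\<open>None\<close> is the value \<open>\<infinity>\<close>.
\<close>

locale ordered_comm_group = comm_group G for G :: "'g monoid" (structure) +
  fixes r :: "'g rel"
  assumes linear: "linear_order_on (carrier G) r"
    and translation: "\<And>a b c. (a, b) \<in> r \<Longrightarrow> c \<in> carrier G \<Longrightarrow> (a \<otimes> c, b \<otimes> c) \<in> r"

fun value_le :: "'g rel \<Rightarrow> 'g option \<Rightarrow> 'g option \<Rightarrow> bool" where
  "value_le r _ None = True"
| "value_le r None (Some h) = False"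
| "value_le r (Some g) (Some h) = ((g, h) \<in> r)"

text \<open>The last axiom is \<open>v (x + y) \<ge> min (v x) (v y)\<close>.\<close>

locale krull_valuation = ordered_comm_group G r for G :: "'g monoid" (structure) and r :: "'g rel" +
  fixes v :: "'a::field \<Rightarrow> 'g option"
  assumes value_in_group: "\<And>x g. v x = Some g \<Longrightarrow> g \<in> carrier G"
    and value_infinity_iff: "\<And>x. v x = None \<longleftrightarrow> x = 0"
    and value_mult: "\<And>x y g h. v x = Some g \<Longrightarrow> v y = Some h \<Longrightarrow> v (x * y) = Some (g \<otimes> h)"
    and value_add: "\<And>x y. value_le r (v x) (v (x + y)) \<or> value_le r (v y) (v (x + y))"

definition nonneg_set :: "'g monoid \<Rightarrow> 'g rel \<Rightarrow> ('a \<Rightarrow> 'g option) \<Rightarrow> 'a set" where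
  "nonneg_set G r v = {x. value_le r (Some \<one>\<^bsub>G\<^esub>) (v x)}"

definition pos_set :: "'g monoid \<Rightarrow> 'g rel \<Rightarrow> ('a \<Rightarrow> 'g option) \<Rightarrow> 'a set" where
  "pos_set G r v = {x. value_le r (Some \<one>\<^bsub>G\<^esub>) (v x) \<and> v x \<noteq> Some \<one>\<^bsub>G\<^esub>}"

context krull_valuation
begin

lemma zero_nonneg: "0 \<in> nonneg_set G r v"
  using value_infinity_iff[of 0] by (simp add: nonneg_set_def)

lemma value_one: "v 1 = Some \<one>"
proof -
  obtain g where g: "v 1 = Some g" using value_infinity_iff[of 1] by auto
  then have "g \<otimes> g = g" "g \<in> carrier G"
    using value_mult[OF g g] value_in_group[OF g] by auto
  then show ?thesis using g by (metis l_cancel_one)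
qed

lemma order_refl: "g \<in> carrier G \<Longrightarrow> (g, g) \<in> r"
  using linear by (auto simp: order_on_defs refl_on_def)

lemma order_trans: "(a, b) \<in> r \<Longrightarrow> (b, c) \<in> r \<Longrightarrow> (a, c) \<in> r"
  using linear unfolding order_on_defs by (meson transD)

lemma order_antisym: "(a, b) \<in> r \<Longrightarrow> (b, a) \<in> r \<Longrightarrow> a = b"
  using linear unfolding order_on_defs by (meson antisymD)

lemma order_total: "a \<in> carrier G \<Longrightarrow> b \<in> carrier G \<Longrightarrow> (a, b) \<in> r \<or> (b, a) \<in> r"
  using linear order_refl unfolding order_on_defs total_on_def by metis

lemma value_cases:
  assumes "x \<noteq> 0" obtains g where "v x = Some g" "g \<in> carrier G"
  using assms value_infinity_iff value_in_group by (cases "v x") auto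

lemma value_le_divide_iff:
  assumes "x \<noteq> 0" "y \<noteq> 0"
  shows "value_le r (v x) (v y) \<longleftrightarrow> y / x \<in> nonneg_set G r v"
proof -
  obtain g where g: "v x = Some g" "g \<in> carrier G" using assms value_cases by blast
  obtain h where h: "v (y / x) = Some h" "h \<in> carrier G"
    using assms value_cases[of "y / x"] by auto
  have y: "v y = Some (h \<otimes> g)" using value_mult[OF h(1) g(1)] assms by simp
  have "(g, h \<otimes> g) \<in> r" if "(\<one>, h) \<in> r" using translation[OF that g(2)] g by simp
  moreover have "(\<one>, h) \<in> r" if "(g, h \<otimes> g) \<in> r"
    using translation[OF that inv_closed[OF g(2)]] g h by (simp add: m_assoc)
  ultimately show ?thesis using g h y by (auto simp: nonneg_set_def)
qed

lemma value_eq_iff: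
  "v x = v y \<longleftrightarrow> (if x = 0 \<or> y = 0 then x = y
     else x / y \<in> nonneg_set G r v \<and> y / x \<in> nonneg_set G r v)"
proof (cases "x = 0 \<or> y = 0")
  case True
  then show ?thesis using value_infinity_iff by metis
next
  case False
  then obtain g h where gh: "v x = Some g" "g \<in> carrier G" "v y = Some h" "h \<in> carrier G"
    using value_infinity_iff[of x] value_infinity_iff[of y] value_in_group by fastforce
  have "g = h \<longleftrightarrow> (g, h) \<in> r \<and> (h, g) \<in> r" using order_refl order_antisym gh by blast
  then show ?thesis
    using False gh value_le_divide_iff[of x y] value_le_divide_iff[of y x] by auto
qed

lemma pos_iff:
  "x \<in> pos_set G r v \<longleftrightarrow> x \<in> nonneg_set G r v \<and> (x = 0 \<or> inverse x \<notin> nonneg_set G r v)"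
  using value_eq_iff[of x 1] zero_nonneg value_one
  by (auto simp: pos_set_def nonneg_set_def divide_inverse)

end

definition valuation_ring :: "'a::field set \<Rightarrow> bool" where
  "valuation_ring A \<longleftrightarrow> 1 \<in> A \<and> (\<forall>x\<in>A. \<forall>y\<in>A. x - y \<in> A \<and> x * y \<in> A) \<and>
     (\<forall>x. x \<in> A \<or> inverse x \<in> A)"

lemma (in krull_valuation) valuation_ring_nonneg_set: "valuation_ring (nonneg_set G r v)"
proof -
  let ?A = "nonneg_set G r v"
  have one: "1 \<in> ?A" using value_one order_refl by (simp add: nonneg_set_def)
  have mult: "x * y \<in> ?A" if xy: "x \<in> ?A" "y \<in> ?A" for x y
  proof (cases "x = 0 \<or> y = 0")
    case True then show ?thesis using zero_nonneg by auto
  next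
    case False
    then have "value_le r (v x) (v (x * y))" using value_le_divide_iff[of x "x * y"] xy by simp
    moreover obtain g h where "v x = Some g" "v (x * y) = Some h"
      using False value_infinity_iff[of x] value_infinity_iff[of "x * y"] by auto
    ultimately show ?thesis using xy(1) by (auto simp: nonneg_set_def intro: order_trans)
  qed
  have tot: "x \<in> ?A \<or> inverse x \<in> ?A" for x
  proof (cases "x = 0")
    case True then show ?thesis using zero_nonneg by simp
  next
    case False
    then obtain g where "v x = Some g" "g \<in> carrier G" using value_cases by blast
    then show ?thesis using value_le_divide_iff[of 1 x] value_le_divide_iff[of x 1] False value_one
        order_total[of \<one> g] by (auto simp: divide_inverse)
  qed
  have neg1: "-1 \<in> ?A" using tot[of "-1"] by simp
  have add: "x + y \<in> ?A" if xy: "x \<in> ?A" "y \<in> ?A" for x y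
  proof (cases "v (x + y)")
    case None then show ?thesis by (simp add: nonneg_set_def)
  next
    case (Some g)
    with value_add[of x y] xy show ?thesis
      by (cases "v x"; cases "v y") (auto simp: nonneg_set_def intro: order_trans)
  qed
  have "x - y \<in> ?A" if "x \<in> ?A" "y \<in> ?A" for x y
    using add[OF that(1) mult[OF neg1 that(2)]] by simp
  then show ?thesis using one mult tot unfolding valuation_ring_def by blast
qed

text \<open>
  Every valuation ring of \<open>K\<close> comes from a valuation whose value group \<open>K\<^sup>\<times>/\<O>\<^sup>\<times>\<close> has as elements
  cosets, which are sets of elements of \<open>K\<close>. Hence valuations with value group in the type
  \<open>'a set\<close> represent all Krull valuations on \<open>'a\<close> up to equivalence.
\<close>

definition unit_coset :: "'a::field set \<Rightarrow> 'a \<Rightarrow> 'a set" where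
  "unit_coset A x = {y. y \<noteq> 0 \<and> y / x \<in> A \<and> x / y \<in> A}"

definition coset_group :: "'a::field set \<Rightarrow> 'a set monoid" where
  "coset_group A = \<lparr>carrier = unit_coset A ` (- {0}),
     mult = (\<lambda>P Q. unit_coset A ((SOME x. x \<in> P) * (SOME y. y \<in> Q))), one = unit_coset A 1\<rparr>"

definition coset_order :: "'a::field set \<Rightarrow> 'a set rel" where
  "coset_order A = {(unit_coset A x, unit_coset A y) | x y. x \<noteq> 0 \<and> y \<noteq> 0 \<and> y / x \<in> A}"

definition coset_value :: "'a::field set \<Rightarrow> 'a \<Rightarrow> 'a set option" where
  "coset_value A x = (if x = 0 then None else Some (unit_coset A x))"

context
  fixes A :: "'a::field set"
  assumes A: "valuation_ring A"
begin

lemma ring_one: "1 \<in> A" and ring_mult: "x \<in> A \<Longrightarrow> y \<in> A \<Longrightarrow> x * y \<in> A"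
  and ring_diff: "x \<in> A \<Longrightarrow> y \<in> A \<Longrightarrow> x - y \<in> A" and ring_total: "x \<in> A \<or> inverse x \<in> A"
  using A by (auto simp: valuation_ring_def)

lemma ring_add: "x \<in> A \<Longrightarrow> y \<in> A \<Longrightarrow> x + y \<in> A"
  using ring_diff[of x "(1 - 1) - y"] ring_diff[of "1 - 1" y] ring_diff[OF ring_one ring_one] by simp

lemma ring_divide_trans:
  assumes "y \<noteq> 0" "x / y \<in> A" "y / z \<in> A" shows "x / z \<in> A"
  using ring_mult[OF assms(2,3)] assms(1) by simp

lemma unit_coset_eq_iff:
  assumes "x \<noteq> 0" "y \<noteq> 0"
  shows "unit_coset A x = unit_coset A y \<longleftrightarrow> x / y \<in> A \<and> y / x \<in> A"
proof
  assume "unit_coset A x = unit_coset A y"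
  moreover have "x \<in> unit_coset A x" using assms ring_one by (simp add: unit_coset_def)
  ultimately show "x / y \<in> A \<and> y / x \<in> A" by (simp add: unit_coset_def)
next
  assume "x / y \<in> A \<and> y / x \<in> A"
  then show "unit_coset A x = unit_coset A y"
    using assms by (auto simp: unit_coset_def intro: ring_divide_trans)
qed

lemma some_unit_coset:
  assumes "x \<noteq> 0"
  shows "(SOME y. y \<in> unit_coset A x) \<noteq> 0"
    and "unit_coset A (SOME y. y \<in> unit_coset A x) = unit_coset A x"
proof -
  have "x \<in> unit_coset A x" using assms ring_one by (simp add: unit_coset_def)
  then have *: "(SOME y. y \<in> unit_coset A x) \<in> unit_coset A x" by (rule someI)
  then show "(SOME y. y \<in> unit_coset A x) \<noteq> 0" by (simp add: unit_coset_def)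
  then show "unit_coset A (SOME y. y \<in> unit_coset A x) = unit_coset A x"
    using * assms by (subst unit_coset_eq_iff) (auto simp: unit_coset_def)
qed

lemma unit_coset_mult_cong:
  assumes "x \<noteq> 0" "y \<noteq> 0" "x' \<noteq> 0" "y' \<noteq> 0"
    and "unit_coset A x = unit_coset A x'" "unit_coset A y = unit_coset A y'"
  shows "unit_coset A (x * y) = unit_coset A (x' * y')"
proof -
  have h: "x / x' \<in> A" "x' / x \<in> A" "y / y' \<in> A" "y' / y \<in> A"
    using assms unit_coset_eq_iff by auto
  show ?thesis using ring_mult[OF h(1,3)] ring_mult[OF h(2,4)] assms
    by (subst unit_coset_eq_iff) auto
qed

lemma coset_group_mult:
  assumes "x \<noteq> 0" "y \<noteq> 0"
  shows "unit_coset A x \<otimes>\<^bsub>coset_group A\<^esub> unit_coset A y = unit_coset A (x * y)"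
  unfolding coset_group_def monoid.simps
  by (rule unit_coset_mult_cong) (simp_all add: some_unit_coset assms)

lemma coset_order_iff:
  assumes "x \<noteq> 0" "y \<noteq> 0"
  shows "(unit_coset A x, unit_coset A y) \<in> coset_order A \<longleftrightarrow> y / x \<in> A"
proof
  assume "(unit_coset A x, unit_coset A y) \<in> coset_order A"
  then obtain x' y' where h: "unit_coset A x = unit_coset A x'" "unit_coset A y = unit_coset A y'"
    "x' \<noteq> 0" "y' \<noteq> 0" "y' / x' \<in> A" by (auto simp: coset_order_def)
  then have "y / y' \<in> A" "x' / x \<in> A" using assms unit_coset_eq_iff by auto
  then have "y / x' \<in> A" using h ring_divide_trans[of y' y x'] by simp
  then show "y / x \<in> A" using h \<open>x' / x \<in> A\<close> ring_divide_trans[of x' y x] by simp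
qed (use assms in \<open>auto simp: coset_order_def\<close>)

lemma comm_group_coset_group: "comm_group (coset_group A)"
proof (rule comm_groupI)
  fix P Q R assume "P \<in> carrier (coset_group A)" "Q \<in> carrier (coset_group A)"
    "R \<in> carrier (coset_group A)"
  then obtain x y z where "x \<noteq> 0" "y \<noteq> 0" "z \<noteq> 0"
    "P = unit_coset A x" "Q = unit_coset A y" "R = unit_coset A z"
    by (auto simp: coset_group_def)
  then show "P \<otimes>\<^bsub>coset_group A\<^esub> Q \<otimes>\<^bsub>coset_group A\<^esub> R
    = P \<otimes>\<^bsub>coset_group A\<^esub> (Q \<otimes>\<^bsub>coset_group A\<^esub> R)"
    by (simp add: coset_group_mult mult.assoc)
next
  fix P Q assume "P \<in> carrier (coset_group A)" "Q \<in> carrier (coset_group A)"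
  then obtain x y where h: "x \<noteq> 0" "y \<noteq> 0" "P = unit_coset A x" "Q = unit_coset A y"
    by (auto simp: coset_group_def)
  then show "P \<otimes>\<^bsub>coset_group A\<^esub> Q = Q \<otimes>\<^bsub>coset_group A\<^esub> P"
    by (simp add: coset_group_mult mult.commute)
  have "unit_coset A (x * y) \<in> carrier (coset_group A)" using h by (simp add: coset_group_def)
  then show "P \<otimes>\<^bsub>coset_group A\<^esub> Q \<in> carrier (coset_group A)" using h by (simp add: coset_group_mult)
next
  show "\<one>\<^bsub>coset_group A\<^esub> \<in> carrier (coset_group A)" by (simp add: coset_group_def)
next
  fix P assume "P \<in> carrier (coset_group A)"
  then obtain x where h: "x \<noteq> 0" "P = unit_coset A x" by (auto simp: coset_group_def)
  have one: "\<one>\<^bsub>coset_group A\<^esub> = unit_coset A 1" by (simp add: coset_group_def)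
  show "\<one>\<^bsub>coset_group A\<^esub> \<otimes>\<^bsub>coset_group A\<^esub> P = P" using h coset_group_mult[of 1 x] by (simp add: one)
  have "unit_coset A (inverse x) \<in> carrier (coset_group A)"
    using h by (auto simp: coset_group_def)
  moreover have "unit_coset A (inverse x) \<otimes>\<^bsub>coset_group A\<^esub> P = \<one>\<^bsub>coset_group A\<^esub>"
    using h coset_group_mult[of "inverse x" x] by (simp add: one)
  ultimately show "\<exists>Q\<in>carrier (coset_group A). Q \<otimes>\<^bsub>coset_group A\<^esub> P = \<one>\<^bsub>coset_group A\<^esub>" by blast
qed

lemma linear_order_coset_order: "linear_order_on (carrier (coset_group A)) (coset_order A)"
proof -
  have "coset_order A \<subseteq> carrier (coset_group A) \<times> carrier (coset_group A)"
    by (auto simp: coset_order_def coset_group_def)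
  moreover have "refl_on (carrier (coset_group A)) (coset_order A)"
    by (auto simp: refl_on_def coset_group_def coset_order_iff ring_one)
  moreover have "trans (coset_order A)"
  proof (rule transI)
    fix P Q R assume "(P, Q) \<in> coset_order A" "(Q, R) \<in> coset_order A"
    moreover from this obtain x y z where "x \<noteq> 0" "y \<noteq> 0" "z \<noteq> 0"
      "P = unit_coset A x" "Q = unit_coset A y" "R = unit_coset A z"
      by (auto simp: coset_order_def)
    ultimately show "(P, R) \<in> coset_order A"
      by (auto simp: coset_order_iff intro: ring_divide_trans)
  qed
  moreover have "antisym (coset_order A)"
  proof (rule antisymI)
    fix P Q assume "(P, Q) \<in> coset_order A" "(Q, P) \<in> coset_order A"
    moreover from this obtain x y where "x \<noteq> 0" "y \<noteq> 0"
      "P = unit_coset A x" "Q = unit_coset A y"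
      by (auto simp: coset_order_def)
    ultimately show "P = Q" by (auto simp: coset_order_iff unit_coset_eq_iff)
  qed
  moreover have "total_on (carrier (coset_group A)) (coset_order A)"
  proof (rule total_onI)
    fix P Q assume "P \<in> carrier (coset_group A)" "Q \<in> carrier (coset_group A)"
    then obtain x y where "x \<noteq> 0" "y \<noteq> 0" "P = unit_coset A x" "Q = unit_coset A y"
      by (auto simp: coset_group_def)
    then show "(P, Q) \<in> coset_order A \<or> (Q, P) \<in> coset_order A"
      using ring_total[of "x / y"] by (auto simp: coset_order_iff)
  qed
  ultimately show ?thesis unfolding order_on_defs by blast
qed

lemma krull_valuation_coset_value: "krull_valuation (coset_group A) (coset_order A) (coset_value A)"
proof -
  interpret comm_group "coset_group A" by (rule comm_group_coset_group)
  show ?thesis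
  proof (unfold_locales, rule linear_order_coset_order)
    fix P Q R assume PQ: "(P, Q) \<in> coset_order A" and "R \<in> carrier (coset_group A)"
    then obtain x y z where "x \<noteq> 0" "y \<noteq> 0" "z \<noteq> 0"
      "P = unit_coset A x" "Q = unit_coset A y" "R = unit_coset A z"
      by (auto simp: coset_order_def coset_group_def)
    then show "(P \<otimes>\<^bsub>coset_group A\<^esub> R, Q \<otimes>\<^bsub>coset_group A\<^esub> R) \<in> coset_order A"
      using PQ by (simp add: coset_order_iff coset_group_mult)
  next
    fix x g assume "coset_value A x = Some g"
    then show "g \<in> carrier (coset_group A)"
      by (auto simp: coset_value_def coset_group_def split: if_splits)
  next
    fix x show "coset_value A x = None \<longleftrightarrow> x = 0" by (simp add: coset_value_def)
  next
    fix x y g h assume "coset_value A x = Some g" "coset_value A y = Some h"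
    then show "coset_value A (x * y) = Some (g \<otimes>\<^bsub>coset_group A\<^esub> h)"
      by (auto simp: coset_value_def coset_group_mult split: if_splits)
  next
    fix x y
    have *: "(x + y) / x \<in> A" if "y / x \<in> A" "x \<noteq> 0" for x y
      using ring_add[OF ring_one that(1)] that(2) by (simp add: add_divide_distrib)
    have "(x + y) / x \<in> A \<or> (x + y) / y \<in> A" if "x \<noteq> 0" "y \<noteq> 0"
      using ring_total[of "y / x"] *[of y x] *[of x y] that by (auto simp: add.commute)
    then show "value_le (coset_order A) (coset_value A x) (coset_value A (x + y)) \<or>
      value_le (coset_order A) (coset_value A y) (coset_value A (x + y))"
      by (auto simp: coset_value_def coset_order_iff ring_one)
  qed
qed

lemma nonneg_set_coset_value: "nonneg_set (coset_group A) (coset_order A) (coset_value A) = A"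
proof -
  have "\<one>\<^bsub>coset_group A\<^esub> = unit_coset A 1" by (simp add: coset_group_def)
  then show ?thesis using ring_diff[OF ring_one ring_one]
    by (auto simp: nonneg_set_def coset_value_def coset_order_iff split: if_splits)
qed

end

text \<open>Two Krull valuations are equivalent if they have the same valuation ring.\<close>

definition valuation_rel ::
  "'a set monoid \<times> 'a set rel \<times> ('a::field \<Rightarrow> 'a set option) \<Rightarrow>
   'a set monoid \<times> 'a set rel \<times> ('a \<Rightarrow> 'a set option) \<Rightarrow> bool" where
  "valuation_rel = (\<lambda>(G, r, v) (H, s, w). krull_valuation G r v \<and> krull_valuation H s w \<and>
     nonneg_set G r v = nonneg_set H s w)"

lemma valuation_ring_UNIV: "valuation_ring UNIV"
  by (simp add: valuation_ring_def)

quotient_type (overloaded) 'a S_val =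
  "'a set monoid \<times> 'a set rel \<times> ('a::field \<Rightarrow> 'a set option)" / partial: valuation_rel
proof (rule part_equivpI)
  show "\<exists>V :: 'a set monoid \<times> 'a set rel \<times> ('a \<Rightarrow> 'a set option). valuation_rel V V"
    using krull_valuation_coset_value[OF valuation_ring_UNIV]
    by (intro exI[of _ "(coset_group UNIV, coset_order UNIV, coset_value UNIV)"])
       (simp add: valuation_rel_def)
  show "symp (valuation_rel :: 'a set monoid \<times> 'a set rel \<times> ('a \<Rightarrow> 'a set option) \<Rightarrow> _)"
    by (auto simp: symp_def valuation_rel_def)
  show "transp (valuation_rel :: 'a set monoid \<times> 'a set rel \<times> ('a \<Rightarrow> 'a set option) \<Rightarrow> _)"
    by (auto simp: transp_def valuation_rel_def)
qed

lift_definition val_ring :: "'a::field S_val \<Rightarrow> 'a set" ("\<O>") is "\<lambda>(G, r, v). nonneg_set G r v"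
  by (auto simp: valuation_rel_def)

lift_definition val_ideal :: "'a::field S_val \<Rightarrow> 'a set" ("\<mm>") is "\<lambda>(G, r, v). pos_set G r v"
  by (auto simp: valuation_rel_def krull_valuation.pos_iff)

text \<open>The relation \<open>v(x) = v(y)\<close>.\<close>

lift_definition val_eq :: "'a::field S_val \<Rightarrow> 'a \<Rightarrow> 'a \<Rightarrow> bool" is "\<lambda>(G, r, v) x y. v x = v y"
  by (auto simp: valuation_rel_def krull_valuation.value_eq_iff fun_eq_iff)

definition val_units :: "'a::field S_val \<Rightarrow> 'a set" where
  "val_units v = \<O> v - \<mm> v"

lemma valuation_ring_val_ring: "valuation_ring (\<O> v)"
  by transfer (auto simp: valuation_rel_def krull_valuation.valuation_ring_nonneg_set)

lemma val_ring_inject: "\<O> v = \<O> w \<longleftrightarrow> v = w"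
  by transfer (auto simp: valuation_rel_def)

lemma val_ring_surj: "valuation_ring A \<Longrightarrow> \<exists>v. \<O> v = A"
proof transfer
  fix A :: "'a set" assume "valuation_ring A"
  then show "\<exists>V\<in>{V. valuation_rel V V}. (case V of (G, r, v) \<Rightarrow> nonneg_set G r v) = A"
    using krull_valuation_coset_value nonneg_set_coset_value
    by (intro bexI[of _ "(coset_group A, coset_order A, coset_value A)"]) (auto simp: valuation_rel_def)
qed

lemma krull_valuation_represented:
  fixes G :: "'g monoid" and v :: "'a::field \<Rightarrow> 'g option"
  assumes "krull_valuation G r v"
  shows "\<exists>u :: 'a S_val. \<O> u = nonneg_set G r v \<and> \<mm> u = pos_set G r v \<and>
    (\<forall>x y. val_eq u x y \<longleftrightarrow> v x = v y)"
proof -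
  obtain u :: "'a S_val" where u: "\<O> u = nonneg_set G r v"
    using val_ring_surj krull_valuation.valuation_ring_nonneg_set[OF assms] by blast
  have "\<mm> u = {x. x \<in> \<O> u \<and> (x = 0 \<or> inverse x \<notin> \<O> u)}"
    by transfer (auto simp: valuation_rel_def krull_valuation.pos_iff)
  moreover have "val_eq u x y \<longleftrightarrow>
      (if x = 0 \<or> y = 0 then x = y else x / y \<in> \<O> u \<and> y / x \<in> \<O> u)" for x y
    by transfer (auto simp: valuation_rel_def krull_valuation.value_eq_iff)
  ultimately show ?thesis
    using u krull_valuation.pos_iff[OF assms] krull_valuation.value_eq_iff[OF assms] by auto
qed

section \<open>Refinement, incomparability, independence\<close>

definition refinement_of :: "'a::field S_val \<Rightarrow> 'a S_val \<Rightarrow> bool" where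
  "refinement_of v w \<longleftrightarrow> \<O> v \<subseteq> \<O> w"

definition finest_common_coarsening :: "'a::field S_val \<Rightarrow> 'a S_val \<Rightarrow> 'a S_val \<Rightarrow> bool" where
  "finest_common_coarsening v w u \<longleftrightarrow> refinement_of v u \<and> refinement_of w u \<and>
     (\<forall>u'. refinement_of v u' \<and> refinement_of w u' \<longrightarrow> refinement_of u u')"

definition val_join :: "'a::field S_val \<Rightarrow> 'a S_val \<Rightarrow> 'a S_val" where
  "val_join v w = (THE u. finest_common_coarsening v w u)"

lemma ex1_finest_common_coarsening: "\<exists>!u. finest_common_coarsening v w u"
proof -
  define B where "B = {x. \<forall>u. refinement_of v u \<and> refinement_of w u \<longrightarrow> x \<in> \<O> u}"
  have chain: "\<O> u \<subseteq> \<O> u' \<or> \<O> u' \<subseteq> \<O> u" if h: "refinement_of v u" "refinement_of v u'" for u u'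
  proof (rule ccontr)
    assume "\<not> ?thesis"
    then obtain x y where x: "x \<in> \<O> u" "x \<notin> \<O> u'" and y: "y \<in> \<O> u'" "y \<notin> \<O> u" by blast
    have "0 \<in> \<O> u''" for u'' :: "'a S_val"
      using ring_diff[OF valuation_ring_val_ring ring_one[OF valuation_ring_val_ring]
        ring_one[OF valuation_ring_val_ring]] by simp
    then have nz: "x \<noteq> 0" "y \<noteq> 0" using x y by metis+
    have "x / y \<in> \<O> v \<or> y / x \<in> \<O> v" using ring_total[OF valuation_ring_val_ring, of "x / y" v] by simp
    then show False
    proof
      assume "x / y \<in> \<O> v"
      then have "x / y * y \<in> \<O> u'"
        using h y by (intro ring_mult[OF valuation_ring_val_ring]) (auto simp: refinement_of_def)
      then show False using nz x by simp
    next
      assume "y / x \<in> \<O> v"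
      then have "y / x * x \<in> \<O> u"
        using h x by (intro ring_mult[OF valuation_ring_val_ring]) (auto simp: refinement_of_def)
      then show False using nz y by simp
    qed
  qed
  have "x \<in> B \<or> inverse x \<in> B" for x
  proof (rule ccontr)
    assume "\<not> ?thesis"
    then obtain u u' where "refinement_of v u" "refinement_of v u'" "x \<notin> \<O> u" "inverse x \<notin> \<O> u'"
      by (auto simp: B_def)
    then show False using chain[of u u'] ring_total[OF valuation_ring_val_ring] by blast
  qed
  moreover have "1 \<in> B" "\<And>x y. x \<in> B \<Longrightarrow> y \<in> B \<Longrightarrow> x - y \<in> B \<and> x * y \<in> B"
    by (auto simp: B_def intro: ring_one ring_mult ring_diff valuation_ring_val_ring)
  ultimately have "valuation_ring B" unfolding valuation_ring_def by blast
  then obtain u where "\<O> u = B" using val_ring_surj by blast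
  then have "finest_common_coarsening v w u"
    by (auto simp: finest_common_coarsening_def refinement_of_def B_def)
  moreover have "u' = u''"
    if "finest_common_coarsening v w u'" "finest_common_coarsening v w u''" for u' u''
    using that unfolding finest_common_coarsening_def refinement_of_def
    by (metis val_ring_inject subset_antisym)
  ultimately show ?thesis by blast
qed

definition incomparable_sets :: "'a::field S_val set \<Rightarrow> 'a S_val set \<Rightarrow> bool" where
  "incomparable_sets S T \<longleftrightarrow> (\<forall>v\<in>S. \<forall>w\<in>T. \<not> refinement_of v w \<and> \<not> refinement_of w v)"

definition independent_sets :: "'a::field \<Rightarrow> 'a S_val set \<Rightarrow> 'a S_val set \<Rightarrow> bool" where
  "independent_sets t S T \<longleftrightarrow> (\<forall>v\<in>S. \<forall>w\<in>T. t \<in> val_units (val_join v w))"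

section \<open>Topology and uniformity\<close>

definition zar_star_topology :: "'a::field S_val topology" where
  "zar_star_topology = topology_generated_by {{v. x \<in> \<mm> v} | x. True}"

text \<open>The case \<open>x = 0\<close> puts the whole space into the subbasis.\<close>

lemma topspace_zar_star_topology: "topspace zar_star_topology = UNIV"
proof -
  have "0 \<in> \<mm> v" for v :: "'a S_val"
    by transfer (auto simp: valuation_rel_def krull_valuation.pos_iff krull_valuation.zero_nonneg)
  then show ?thesis unfolding zar_star_topology_def topology_generated_by_topspace by blast
qed

definition uniformity_assumption :: "'a::field S_val set \<Rightarrow> 'a \<Rightarrow> bool" where
  "uniformity_assumption S t \<longleftrightarrow>
    (\<exists>f :: 'a poly. \<exists>d. degree f = d \<and> d \<ge> 2 \<and> (\<forall>v\<in>S.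
      (\<forall>x\<in>\<O> v. poly f x \<in> \<O> v) \<and>
      (\<forall>x\<in>\<O> v. poly f x \<notin> (*) t ` \<mm> v) \<and>
      (\<forall>x. x \<notin> \<O> v \<longrightarrow>
        poly f x \<in> (\<lambda>y. x ^ d * y) ` (\<O> v - (*) t ` \<mm> v) \<inter>
          (\<lambda>y. coeff f d * x ^ d + x ^ (d - 1) * y) ` \<O> v) \<and>
      {x + y | x y. x \<in> \<O> v \<and> y \<in> \<O> v} \<subseteq> (*) (inverse t) ` \<O> v))"

end

theory Submission
  imports Defs
begin

text \<open>
  The homogenization \<open>N(x, y) = y\<^sup>d f(x/y)\<close> satisfies
  \<open>d min(v x, v y) \<le> v (N(x, y)) \<le> d min(v x, v y) + v t\<close> for all \<open>v\<close> in \<open>S\<close>. Iterating it gives, for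
  finitely many elements, a uniform minimum up to a factor \<open>D\<close> and an error of at most \<open>(D - 1) v t\<close>;
  that the error is less than \<open>D v t\<close> uses \<open>d \<ge> 2\<close> and makes it independent of the number of elements.
  Together with compactness, elements that separate single valuations \<open>v\<close>, \<open>w\<close> are thus combined into
  an element \<open>y\<close> with \<open>v y < - v s\<close> on one set and \<open>v y > v s\<close> on the other, where \<open>s\<close> is chosen such
  that \<open>v s\<close> dominates \<open>v t\<close> and \<open>\<bar>v (z\<^sub>1/z\<^sub>2)\<bar>\<close>; compatibility makes \<open>s\<close> again a unit of \<open>v \<or> w\<close>. Then
  \<open>e = a\<^sub>d y\<^sup>d / f(y)\<close> is close to \<open>1\<close> on the first set and close to \<open>0\<close> on the second, and
  \<open>e z\<^sub>1 + (1 - e) z\<^sub>2\<close> solves the problem for two sets. The general case follows by induction, because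
  the solution for \<open>S\<^sub>1 \<union> \<dots> \<union> S\<^bsub>n-1\<^esub>\<close> is again compatible with \<open>z\<^sub>n\<close>.
\<close>

section \<open>Valuation rings and their maximal ideals\<close>

lemmas val_ring_one = ring_one[OF valuation_ring_val_ring]
  and val_ring_mult = ring_mult[OF valuation_ring_val_ring]
  and val_ring_add = ring_add[OF valuation_ring_val_ring]
  and val_ring_diff = ring_diff[OF valuation_ring_val_ring]
  and val_ring_total = ring_total[OF valuation_ring_val_ring]

lemma val_ring_zero: "0 \<in> \<O> v"
  using val_ring_diff[OF val_ring_one val_ring_one] by simp

lemma val_ring_power: "x \<in> \<O> v \<Longrightarrow> x ^ n \<in> \<O> v"
  by (induction n) (auto intro: val_ring_one val_ring_mult)

lemma val_ideal_iff: "x \<in> \<mm> v \<longleftrightarrow> x \<in> \<O> v \<and> (x = 0 \<or> inverse x \<notin> \<O> v)"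
  by transfer (auto simp: valuation_rel_def krull_valuation.pos_iff)

lemma val_eq_iff:
  "val_eq v x y \<longleftrightarrow> (if x = 0 \<or> y = 0 then x = y else x / y \<in> \<O> v \<and> y / x \<in> \<O> v)"
  by transfer (auto simp: valuation_rel_def krull_valuation.value_eq_iff)

lemma val_units_iff: "x \<in> val_units v \<longleftrightarrow> x \<noteq> 0 \<and> x \<in> \<O> v \<and> inverse x \<in> \<O> v"
  by (auto simp: val_units_def val_ideal_iff val_ring_zero)

lemma val_ideal_subset: "x \<in> \<mm> v \<Longrightarrow> x \<in> \<O> v"
  by (simp add: val_ideal_iff)

lemma not_one_val_ideal: "1 \<notin> \<mm> v"
  by (simp add: val_ideal_iff val_ring_one)

lemma val_ideal_mult:
  assumes "x \<in> \<mm> v" "y \<in> \<O> v"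
  shows "x * y \<in> \<mm> v"
proof (cases "x * y = 0")
  case False
  have "inverse (x * y) \<notin> \<O> v"
  proof
    assume "inverse (x * y) \<in> \<O> v"
    then have "y * inverse (x * y) \<in> \<O> v" using assms val_ring_mult by blast
    moreover have "y * inverse (x * y) = inverse x" using False by simp
    ultimately have "inverse x \<in> \<O> v" by metis
    then show False using assms False by (simp add: val_ideal_iff)
  qed
  then show ?thesis using assms by (auto simp: val_ideal_iff val_ring_mult)
qed (auto simp: val_ideal_iff val_ring_zero)

lemma val_ideal_add:
  assumes "x \<in> \<mm> v" "y \<in> \<mm> v"
  shows "x + y \<in> \<mm> v"
proof (cases "x = 0 \<or> y = 0")
  case False
  have *: "a + b \<in> \<mm> v" if "a \<in> \<mm> v" "b / a \<in> \<O> v" "a \<noteq> 0" for a b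
    using val_ideal_mult[OF that(1) val_ring_add[OF val_ring_one that(2)]] that(3)
    by (simp add: algebra_simps)
  show ?thesis
    using val_ring_total[of "y / x" v] *[of x y] *[of y x] False assms by (auto simp: add.commute)
qed (use assms in auto)

lemma val_ideal_uminus: "x \<in> \<mm> v \<Longrightarrow> - x \<in> \<mm> v"
  using val_ideal_mult[of x v "-1"] val_ring_diff[OF val_ring_zero val_ring_one, of v] by simp

lemma val_ideal_diff: "x \<in> \<mm> v \<Longrightarrow> y \<in> \<mm> v \<Longrightarrow> x - y \<in> \<mm> v"
  using val_ideal_add[of x v "- y"] val_ideal_uminus[of y v] by simp

lemma val_ideal_power: "x \<in> \<mm> v \<Longrightarrow> 0 < n \<Longrightarrow> x ^ n \<in> \<mm> v"
  by (cases n) (auto intro: val_ideal_mult val_ring_power val_ideal_subset)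

lemma one_add_val_ideal_unit:
  assumes "x \<in> \<mm> v" shows "1 + x \<in> val_units v"
proof -
  have "1 + x \<notin> \<mm> v" using val_ideal_diff[OF _ assms, of "1 + x"] not_one_val_ideal by auto
  then show ?thesis
    using val_ring_add[OF val_ring_one val_ideal_subset[OF assms]] by (simp add: val_units_def)
qed

lemma val_eq_if_unit:
  assumes "x / y \<in> val_units v" shows "val_eq v x y"
  using assms by (auto simp: val_units_iff val_eq_iff)

lemma val_eq_coarsening: "val_eq v x y \<Longrightarrow> refinement_of v w \<Longrightarrow> val_eq w x y"
  by (auto simp: val_eq_iff refinement_of_def split: if_splits)

lemma val_eq_sym: "val_eq v x y \<Longrightarrow> val_eq v y x"
  by (auto simp: val_eq_iff split: if_splits)

lemma val_eq_trans: "val_eq v x y \<Longrightarrow> val_eq v y z \<Longrightarrow> val_eq v x z"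
  by transfer (auto split: prod.splits)

section \<open>Common coarsenings\<close>

lemma val_join_coarsening:
  "refinement_of v (val_join v w)" "refinement_of w (val_join v w)"
  "refinement_of v u \<Longrightarrow> refinement_of w u \<Longrightarrow> refinement_of (val_join v w) u"
  using theI'[OF ex1_finest_common_coarsening[of v w]]
  by (auto simp: val_join_def finest_common_coarsening_def)

text \<open>The products \<open>a * b\<close> already form a ring: of two nonzero products one
  divides the other in \<open>\<O> v\<close>, so their difference is a multiple of one of them by an
  element of \<open>\<O> v\<close>. As an overring of \<open>\<O> v\<close> this is a valuation
  ring, hence a common coarsening, and \<open>val_join v w\<close> lies below it.\<close>

lemma val_join_decompose:
  assumes "x \<in> \<O> (val_join v w)"
  obtains a b where "a \<in> \<O> v" "b \<in> \<O> w" "x = a * b"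
proof -
  define B where "B = {a * b | a b. a \<in> \<O> v \<and> b \<in> \<O> w}"
  have vB: "\<O> v \<subseteq> B" and wB: "\<O> w \<subseteq> B"
    unfolding B_def using val_ring_one[of v] val_ring_one[of w] by force+
  have mult: "x * y \<in> B" if xy: "x \<in> B" "y \<in> B" for x y
  proof -
    obtain a b a' b' where *: "a \<in> \<O> v" "b \<in> \<O> w" "x = a * b" "a' \<in> \<O> v" "b' \<in> \<O> w" "y = a' * b'"
      using xy by (auto simp: B_def)
    then have "x * y = (a * a') * (b * b')" by (simp add: algebra_simps)
    then show ?thesis using * val_ring_mult unfolding B_def by blast
  qed
  have neg: "- x \<in> B" if "x \<in> B" for x
    using mult[OF that, of "-1"] vB val_ring_diff[OF val_ring_zero val_ring_one, of v] by auto
  have *: "x - y \<in> B" if "x \<in> B" "y / x \<in> \<O> v" "x \<noteq> 0" for x y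
    using mult[OF that(1), of "1 - y / x"] vB val_ring_diff[OF val_ring_one that(2)] that(3)
    by (auto simp: algebra_simps)
  have "x - y \<in> B" if xy: "x \<in> B" "y \<in> B" for x y
  proof (cases "x = 0 \<or> y = 0")
    case True then show ?thesis using xy neg by auto
  next
    case False
    then show ?thesis
      using val_ring_total[of "y / x" v] *[of x y] *[of y x] xy neg[of "y - x"] by auto
  qed
  moreover have "1 \<in> B" "\<And>x. x \<in> B \<or> inverse x \<in> B"
    using vB val_ring_one[of v] val_ring_total[of _ v] by auto
  ultimately have "valuation_ring B" unfolding valuation_ring_def by (simp add: mult)
  then obtain u where u: "\<O> u = B" using val_ring_surj by blast
  have "\<O> (val_join v w) \<subseteq> B"
    using val_join_coarsening(3)[of v u w] vB wB by (simp add: refinement_of_def u)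
  then show ?thesis using assms that by (auto simp: B_def)
qed

lemma separating_element:
  assumes "\<not> refinement_of v w" "\<not> refinement_of w v" and s: "s \<in> val_units (val_join v w)"
  obtains x where "x \<noteq> 0" "x / s \<in> \<mm> v" "1 / (x * s) \<in> \<mm> w"
proof -
  obtain p q where p: "p \<in> \<O> v" "p \<notin> \<O> w" and q: "q \<in> \<O> w" "q \<notin> \<O> v"
    using assms by (auto simp: refinement_of_def)
  then have nz: "p \<noteq> 0" "q \<noteq> 0" using val_ring_zero by auto
  have "inverse p \<in> \<mm> w" "inverse q \<in> \<mm> v"
    using val_ring_total[of p w] val_ring_total[of q v] p q by (auto simp: val_ideal_iff)
  then have pq: "p / q \<in> \<mm> v" "q / p \<in> \<mm> w"
    using val_ideal_mult[OF _ p(1), of "inverse q"] val_ideal_mult[OF _ q(1), of "inverse p"]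
    by (simp_all add: divide_inverse mult.commute)
  have s0: "s \<noteq> 0" using s by (simp add: val_units_iff)
  \<comment> \<open>This is where independence enters: s is a unit of the join, so its inverse
    splits into a part integral at v and a part integral at w.\<close>
  obtain a b where ab: "a \<in> \<O> v" "b \<in> \<O> w" "inverse s = a * b"
    using s val_join_decompose[of "inverse s" v w] by (auto simp: val_units_iff)
  have ab0: "a \<noteq> 0" "b \<noteq> 0" using ab s0 by auto
  have s_eq: "s = 1 / (a * b)" using ab(3) by (metis inverse_eq_divide inverse_inverse_eq)
  \<comment> \<open>The factor \<open>p / q\<close> has positive value at v and negative value at w.
    The factor \<open>a / b\<close> widens the gap, because dividing by
    \<open>s = 1 / (a * b)\<close> leaves the integral square \<open>a * a\<close>, and inverting
    \<open>?x * s\<close> leaves \<open>b * b\<close>.\<close>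
  let ?x = "a / b * (p / q)"
  have "?x / s = p / q * (a * a)" "1 / (?x * s) = q / p * (b * b)"
    using ab0 nz by (auto simp: s_eq field_simps)
  then have "?x / s \<in> \<mm> v" "1 / (?x * s) \<in> \<mm> w"
    using val_ideal_mult[OF pq(1) val_ring_mult[OF ab(1,1)]]
      val_ideal_mult[OF pq(2) val_ring_mult[OF ab(2,2)]] by auto
  then show ?thesis using that[of ?x] ab0 nz by simp
qed

section \<open>Uniform minima\<close>

lemma openin_val_ideal: "openin zar_star_topology {v. x \<in> \<mm> v}"
  unfolding zar_star_topology_def by (rule topology_generated_by_Basis) blast

locale uniform_valuations =
  fixes S :: "'a::field S_val set" and t :: 'a and f :: "'a poly" and d :: nat
  assumes t_nonzero: "t \<noteq> 0" and degree_ge: "d \<ge> 2"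
    and nonneg: "v \<in> S \<Longrightarrow> x \<in> \<O> v \<Longrightarrow> poly f x \<in> \<O> v \<and> poly f x \<notin> (*) t ` \<mm> v"
    and neg: "v \<in> S \<Longrightarrow> x \<notin> \<O> v \<Longrightarrow> poly f x \<in> (\<lambda>y. x ^ d * y) ` (\<O> v - (*) t ` \<mm> v) \<inter>
          (\<lambda>y. coeff f d * x ^ d + x ^ (d - 1) * y) ` \<O> v"
begin

text \<open>The bound v y \<le> v t takes the form \<open>t / y \<in> \<O> v\<close>, so that later
  estimates are products of ring elements.\<close>

lemma not_in_scaled_val_ideal:
  assumes "y \<notin> (*) t ` \<mm> v" shows "y \<noteq> 0" "t / y \<in> \<O> v"
proof -
  have "y = t * (y / t)" using t_nonzero by simp
  then have *: "y / t \<notin> \<mm> v" using assms by blast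
  then show "y \<noteq> 0" by (auto simp: val_ideal_iff val_ring_zero)
  show "t / y \<in> \<O> v" using * val_ring_total[of "y / t" v] by (auto simp: val_ideal_iff)
qed

lemma poly_nonneg:
  assumes "v \<in> S" "x \<in> \<O> v"
  shows "poly f x \<in> \<O> v" "poly f x \<noteq> 0" "t / poly f x \<in> \<O> v"
  using nonneg[OF assms] not_in_scaled_val_ideal by auto

lemma poly_neg:
  assumes "v \<in> S" "x \<notin> \<O> v"
  shows "poly f x / x ^ d \<in> \<O> v" "poly f x \<noteq> 0" "t * x ^ d / poly f x \<in> \<O> v"
    "(poly f x - coeff f d * x ^ d) / x ^ (d - 1) \<in> \<O> v"
proof -
  have x: "x \<noteq> 0" using assms val_ring_zero by auto
  obtain y z where y: "y \<in> \<O> v" "y \<notin> (*) t ` \<mm> v" "poly f x = x ^ d * y"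
    and z: "z \<in> \<O> v" "poly f x = coeff f d * x ^ d + x ^ (d - 1) * z"
    using neg[OF assms] by blast
  show "poly f x / x ^ d \<in> \<O> v" using x y by simp
  show "poly f x \<noteq> 0" using x y not_in_scaled_val_ideal by simp
  show "t * x ^ d / poly f x \<in> \<O> v" using x y not_in_scaled_val_ideal(2) by simp
  show "(poly f x - coeff f d * x ^ d) / x ^ (d - 1) \<in> \<O> v" using x z by simp
qed

text \<open>Both f(0) and t / f(0) are integral, and t is their product.\<close>

lemma t_in_val_ring: assumes "v \<in> S" shows "t \<in> \<O> v"
  using val_ring_mult[OF poly_nonneg(3) poly_nonneg(1), OF assms val_ring_zero assms val_ring_zero]
    poly_nonneg(2)[OF assms val_ring_zero] by simp

text \<open>The leading coefficient is f(x) / x^d minus 1/x times the integral remainder of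
  condition (iii). An x outside the ring is required because (iii) speaks only of such x.\<close>

lemma lead_coeff_in_val_ring:
  assumes v: "v \<in> S" and x: "x \<notin> \<O> v" shows "coeff f d \<in> \<O> v"
proof -
  have x0: "x \<noteq> 0" using x val_ring_zero by auto
  have "inverse x \<in> \<O> v" using x val_ring_total by blast
  note val_ring_diff[OF poly_neg(1)[OF v x] val_ring_mult[OF poly_neg(4)[OF v x] this]]
  moreover have "x ^ d = x ^ (d - 1) * x" using degree_ge by (cases d) auto
  ultimately show ?thesis using x0 by (simp add: field_simps)
qed

lemma binary_min:
  assumes "x \<noteq> 0" "y \<noteq> 0"
  obtains z where "z \<noteq> 0"
    "\<And>v. v \<in> S \<Longrightarrow> (z / x ^ d \<in> \<O> v \<or> z / y ^ d \<in> \<O> v) \<and> t * x ^ d / z \<in> \<O> v \<and> t * y ^ d / z \<in> \<O> v"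
proof (cases "S = {}")
  case True then show ?thesis using that[of 1] by simp
next
  case False
  let ?z = "y ^ d * poly f (x / y)"
  \<comment> \<open>Nonvanishing is read off at any one valuation in S, whence the separate
    treatment of empty S.\<close>
  have nz: "poly f (x / y) \<noteq> 0" using False poly_nonneg(2) poly_neg(2) by blast
  have "(?z / x ^ d \<in> \<O> v \<or> ?z / y ^ d \<in> \<O> v) \<and> t * x ^ d / ?z \<in> \<O> v \<and> t * y ^ d / ?z \<in> \<O> v"
    if v: "v \<in> S" for v
  proof (cases "x / y \<in> \<O> v")
    case True
    \<comment> \<open>Here y has the smaller value, so the bound for y is immediate and the one for
      x follows on multiplying by (x/y)^d.\<close>
    have "t / poly f (x / y) * (x / y) ^ d \<in> \<O> v"
      using True v by (intro val_ring_mult val_ring_power poly_nonneg)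
    then show ?thesis
      using poly_nonneg[OF v True] assms by (simp add: power_divide ac_simps)
  next
    case False
    then have "y / x \<in> \<O> v" using val_ring_total[of "x / y" v] by simp
    then have "t * (x / y) ^ d / poly f (x / y) * (y / x) ^ d \<in> \<O> v"
      using False v by (intro val_ring_mult val_ring_power poly_neg)
    then show ?thesis using poly_neg[OF v False] assms by (simp add: power_divide ac_simps)
  qed
  then show ?thesis using that[of ?z] nz assms by simp
qed

text \<open>The element y has D times the minimal value, up to an error E v t. Each insertion
  replaces (D, E) by (D d, E d + 1), starting from (1, 0), which preserves E < D.\<close>

lemma finite_min:
  assumes "finite X" "X \<noteq> {}" "0 \<notin> X"
  shows "\<exists>y D E. y \<noteq> 0 \<and> E < D \<and>
    (\<forall>v\<in>S. (\<exists>x\<in>X. y / x ^ D \<in> \<O> v) \<and> (\<forall>x\<in>X. t ^ E * x ^ D / y \<in> \<O> v))"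
  using assms
proof (induction X rule: finite_ne_induct)
  case (singleton a)
  then show ?case
    by (intro exI[of _ a] exI[of _ 1] exI[of _ 0]) (simp add: val_ring_one)
next
  case (insert a F)
  then have "\<exists>y D E. y \<noteq> 0 \<and> E < D \<and>
    (\<forall>v\<in>S. (\<exists>x\<in>F. y / x ^ D \<in> \<O> v) \<and> (\<forall>x\<in>F. t ^ E * x ^ D / y \<in> \<O> v))"
    by simp
  then obtain y D E where y: "y \<noteq> 0" "E < D"
    "\<And>v. v \<in> S \<Longrightarrow> \<exists>x\<in>F. y / x ^ D \<in> \<O> v"
    "\<And>v x. v \<in> S \<Longrightarrow> x \<in> F \<Longrightarrow> t ^ E * x ^ D / y \<in> \<O> v"
    by metis
  have a0: "a \<noteq> 0" "a ^ D \<noteq> 0" using insert.prems by auto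
  \<comment> \<open>Raising a to the power D puts it on the same scale as y.\<close>
  obtain z where z: "z \<noteq> 0"
    "\<And>v. v \<in> S \<Longrightarrow> z / y ^ d \<in> \<O> v \<or> z / (a ^ D) ^ d \<in> \<O> v"
    "\<And>v. v \<in> S \<Longrightarrow> t * y ^ d / z \<in> \<O> v"
    "\<And>v. v \<in> S \<Longrightarrow> t * (a ^ D) ^ d / z \<in> \<O> v"
    using binary_min[OF y(1) a0(2)] by metis
  have "\<exists>x\<in>insert a F. z / x ^ (D * d) \<in> \<O> v" if v: "v \<in> S" for v
  proof (cases "z / (a ^ D) ^ d \<in> \<O> v")
    case True
    then show ?thesis by (auto simp: power_mult)
  next
    case False
    obtain x where x: "x \<in> F" "y / x ^ D \<in> \<O> v" using y(3)[OF v] by blast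
    have "z / y ^ d * (y / x ^ D) ^ d \<in> \<O> v"
      using z(2)[OF v] False x by (intro val_ring_mult val_ring_power) auto
    then have "z / x ^ (D * d) \<in> \<O> v" using y(1) by (simp add: power_divide power_mult)
    then show ?thesis using x by blast
  qed
  moreover have "t ^ (E * d + 1) * x ^ (D * d) / z \<in> \<O> v"
    if v: "v \<in> S" and x: "x \<in> insert a F" for v x
  proof (cases "x = a")
    case True
    have "t * (a ^ D) ^ d / z * t ^ (E * d) \<in> \<O> v"
      using v by (intro val_ring_mult val_ring_power z t_in_val_ring)
    then show ?thesis using True by (simp add: power_mult ac_simps)
  next
    case False
    have "(t ^ E * x ^ D / y) ^ d * (t * y ^ d / z) \<in> \<O> v"
      using v x False by (intro val_ring_mult val_ring_power z y) auto
    then show ?thesis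
      using y(1) by (simp add: power_mult power_mult_distrib power_divide ac_simps)
  qed
  moreover have "E * d + 1 < D * d"
  proof -
    have "E * d + d \<le> D * d" using y(2) by (metis Suc_leI add.commute mult_Suc mult_le_mono1)
    then show ?thesis using degree_ge by linarith
  qed
  ultimately show ?case using z(1) by blast
qed

section \<open>Separation of compact sets of valuations\<close>

text \<open>Separation from each single w in C becomes separation from all of C: finitely many x
  suffice by compactness, and their uniform minimum y inherits the bound on R from every x and the
  bound at w from some x. The error E v t is at most E v s and is absorbed by the D extra factors s
  that k + 1 provides over k.\<close>

lemma separation_step:
  assumes C: "compactin zar_star_topology C" "C \<noteq> {}" and sub: "C \<subseteq> S" "R \<subseteq> S"
    and s: "s \<noteq> 0" "\<And>v. v \<in> S \<Longrightarrow> s \<in> \<O> v \<and> s / t \<in> \<O> v"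
    and sep: "\<And>w. w \<in> C \<Longrightarrow> \<exists>x. x \<noteq> 0 \<and> (\<forall>v\<in>R. x / s ^ Suc k \<in> \<mm> v) \<and> 1 / (x * s ^ Suc k) \<in> \<mm> w"
  obtains y where "y \<noteq> 0" "\<And>v. v \<in> R \<Longrightarrow> y / s ^ k \<in> \<mm> v" "\<And>w. w \<in> C \<Longrightarrow> 1 / (y * s ^ k) \<in> \<mm> w"
proof -
  define P where "P = {x. x \<noteq> 0 \<and> (\<forall>v\<in>R. x / s ^ Suc k \<in> \<mm> v)}"
  define U where "U x = {w. 1 / (x * s ^ Suc k) \<in> \<mm> w}" for x
  have "C \<subseteq> \<Union> (U ` P)" using sep by (fastforce simp: P_def U_def)
  moreover have "\<forall>V\<in>U ` P. openin zar_star_topology V" by (auto simp: U_def openin_val_ideal)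
  ultimately have "\<exists>\<F>. finite \<F> \<and> \<F> \<subseteq> U ` P \<and> C \<subseteq> \<Union> \<F>"
    using C(1) unfolding compactin_def by blast
  then obtain X where X: "finite X" "X \<subseteq> P" "C \<subseteq> \<Union> (U ` X)"
    by (metis finite_subset_image)
  then have "X \<noteq> {}" "0 \<notin> X" using C(2) by (auto simp: P_def)
  from finite_min[OF X(1) this] obtain y D E where y: "y \<noteq> 0" "E < D"
    "\<And>v. v \<in> S \<Longrightarrow> \<exists>x\<in>X. y / x ^ D \<in> \<O> v"
    "\<And>v x. v \<in> S \<Longrightarrow> x \<in> X \<Longrightarrow> t ^ E * x ^ D / y \<in> \<O> v"
    by metis
  \<comment> \<open>Writing D = E + D' + 1 gives the leftover powers of s subtraction-free
    exponents: D(k+1) - k on R and D(k+1) - k - E on C.\<close>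
  obtain D' where D': "D = Suc (E + D')" using y(2) less_iff_Suc_add by auto
  have "y / s ^ k \<in> \<mm> v" if v: "v \<in> R" for v
  proof -
    have vS: "v \<in> S" using v sub by blast
    obtain x where x: "x \<in> X" "y / x ^ D \<in> \<O> v" using y(3) vS by blast
    then have x': "x \<noteq> 0" "x / s ^ Suc k \<in> \<mm> v" using X(2) v by (auto simp: P_def)
    have "(x / s ^ Suc k) ^ D * (y / x ^ D * s ^ ((E + D') * Suc k + 1)) \<in> \<mm> v"
      using vS x x' y(2) s(2)
      by (intro val_ideal_mult val_ideal_power val_ring_mult val_ring_power) auto
    also have "(x / s ^ Suc k) ^ D * (y / x ^ D * s ^ ((E + D') * Suc k + 1)) = y / s ^ k"
    proof -
      have "(s ^ Suc k) ^ D = s ^ ((E + D') * Suc k + 1) * s ^ k"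
        unfolding power_mult[symmetric] power_add[symmetric] D' by (rule arg_cong) simp
      then show ?thesis using x'(1) s(1) by (simp add: power_divide del: power_Suc)
    qed
    finally show ?thesis .
  qed
  moreover have "1 / (y * s ^ k) \<in> \<mm> w" if w: "w \<in> C" for w
  proof -
    have wS: "w \<in> S" using w sub by blast
    obtain x where x: "x \<in> X" "1 / (x * s ^ Suc k) \<in> \<mm> w" using X(3) w by (auto simp: U_def)
    then have x0: "x \<noteq> 0" using X(2) by (auto simp: P_def)
    let ?r = "s ^ ((E + D') * k + D' + 1)"
    have "(1 / (x * s ^ Suc k)) ^ D * (t ^ E * x ^ D / y * ((s / t) ^ E * ?r)) \<in> \<mm> w"
      using wS x y s(2)
      by (intro val_ideal_mult val_ideal_power val_ring_mult val_ring_power) auto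
    also have "(1 / (x * s ^ Suc k)) ^ D * (t ^ E * x ^ D / y * ((s / t) ^ E * ?r)) = 1 / (y * s ^ k)"
    proof -
      have "(s ^ Suc k) ^ D = s ^ E * ?r * s ^ k"
        unfolding power_mult[symmetric] power_add[symmetric] D'
        by (rule arg_cong) (simp add: algebra_simps)
      then show ?thesis using x0 s(1) y(1) t_nonzero
        by (simp add: power_divide power_mult_distrib del: power_Suc)
    qed
    finally show ?thesis .
  qed
  ultimately show ?thesis using that y(1) by blast
qed

lemma separation:
  assumes S1: "compactin zar_star_topology S1" "S1 \<noteq> {}" "S1 \<subseteq> S"
    and S2: "compactin zar_star_topology S2" "S2 \<noteq> {}" "S2 \<subseteq> S"
    and s: "s \<noteq> 0" "\<And>v. v \<in> S \<Longrightarrow> s \<in> \<O> v \<and> s / t \<in> \<O> v"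
    and ind: "independent_sets s S1 S2" "incomparable_sets S1 S2"
  obtains y where "y \<noteq> 0" "\<And>v. v \<in> S1 \<Longrightarrow> 1 / (y * s) \<in> \<mm> v" "\<And>v. v \<in> S2 \<Longrightarrow> y / s \<in> \<mm> v"
proof -
  have "\<exists>x. x \<noteq> 0 \<and> (\<forall>w\<in>S2. x / s ^ Suc 1 \<in> \<mm> w) \<and> 1 / (x * s ^ Suc 1) \<in> \<mm> v" if v: "v \<in> S1" for v
  proof -
    \<comment> \<open>The exponent starts at 3 because each of the two compactness steps, first over
      S2 with v fixed and then over S1, lowers it by one.\<close>
    have "\<exists>x. x \<noteq> 0 \<and> (\<forall>v\<in>{v}. x / s ^ Suc 2 \<in> \<mm> v) \<and> 1 / (x * s ^ Suc 2) \<in> \<mm> w" if w: "w \<in> S2" for w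
    proof -
      have "s ^ Suc 2 \<in> val_units (val_join v w)"
        using ind(1) v w unfolding independent_sets_def val_units_iff power_inverse[symmetric]
        by (auto intro!: val_ring_power val_ring_mult)
      then show ?thesis
        using separating_element[of v w "s ^ Suc 2"] ind(2) v w unfolding incomparable_sets_def
        by (metis singletonD)
    qed
    moreover have "{v} \<subseteq> S" using v S1(3) by blast
    ultimately obtain y where y: "y \<noteq> 0" "\<And>u. u \<in> {v} \<Longrightarrow> y / s ^ 2 \<in> \<mm> u"
      "\<And>w. w \<in> S2 \<Longrightarrow> 1 / (y * s ^ 2) \<in> \<mm> w"
      using separation_step[OF S2(1,2,3) _ s, where R = "{v}" and k = 2] by metis
    then show ?thesis
      \<comment> \<open>Inverting y exchanges the roles of v and S2, as the second compactness step
        requires.\<close>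
      by (intro exI[of _ "1 / y"]) (auto simp: field_simps power2_eq_square)
  qed
  from separation_step[OF S1 S2(3) s this] obtain y where
    "y \<noteq> 0" "\<And>v. v \<in> S2 \<Longrightarrow> y / s ^ 1 \<in> \<mm> v" "\<And>v. v \<in> S1 \<Longrightarrow> 1 / (y * s ^ 1) \<in> \<mm> v"
    by blast
  then show ?thesis using that by simp
qed

text \<open>The minimum z of c and 1/c has value between -d |v c| and -d |v c| + v t. Hence s = t^2
  / z satisfies v (s/t) \<ge> d |v c|, which dominates both v c and -v c, while the lower bound on v
  z keeps s a unit wherever t and c are units.\<close>

lemma bounding_element:
  assumes c: "c \<noteq> 0"
  obtains s where "s \<noteq> 0"
    "\<And>v. v \<in> S \<Longrightarrow> s / t \<in> \<O> v \<and> s / t * c \<in> \<O> v \<and> s / t / c \<in> \<O> v"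
    "\<And>v u. v \<in> S \<Longrightarrow> refinement_of v u \<Longrightarrow> t \<in> val_units u \<Longrightarrow> c \<in> val_units u \<Longrightarrow> s \<in> val_units u"
proof -
  obtain z where z: "z \<noteq> 0"
    "\<And>v. v \<in> S \<Longrightarrow> z / c ^ d \<in> \<O> v \<or> z / inverse c ^ d \<in> \<O> v"
    "\<And>v. v \<in> S \<Longrightarrow> t * c ^ d / z \<in> \<O> v"
    "\<And>v. v \<in> S \<Longrightarrow> t * inverse c ^ d / z \<in> \<O> v"
    using binary_min[of c "inverse c"] c by (metis inverse_zero_imp_zero)
  let ?s = "t * t / z"
  have bound: "?s / t \<in> \<O> v \<and> ?s / t * c \<in> \<O> v \<and> ?s / t / c \<in> \<O> v" if v: "v \<in> S" for v
  proof -
    \<comment> \<open>The element b stands for whichever of c and 1/c is integral at v.\<close>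
    have *: "?s / t \<in> \<O> v \<and> ?s / t * b \<in> \<O> v \<and> ?s / t / b \<in> \<O> v"
      if b: "b \<noteq> 0" "b \<in> \<O> v" "t * inverse b ^ d / z \<in> \<O> v" for b
    proof -
      have "t * inverse b ^ d / z * b ^ d \<in> \<O> v" "t * inverse b ^ d / z * b ^ (d + 1) \<in> \<O> v"
        "t * inverse b ^ d / z * b ^ (d - 1) \<in> \<O> v"
        using b by (blast intro: val_ring_mult val_ring_power)+
      moreover have "b ^ d = b ^ (d - 1) * b" using degree_ge by (cases d) auto
      ultimately show ?thesis using t_nonzero b(1) by (simp add: field_simps)
    qed
    from val_ring_total[of c v] show ?thesis
      using *[of c] *[of "inverse c"] z(3,4)[OF v] c by (auto simp: divide_inverse)
  qed
  have "?s \<in> val_units u"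
    if u: "v \<in> S" "refinement_of v u" "t \<in> val_units u" "c \<in> val_units u" for v u
  proof -
    have sub: "\<O> v \<subseteq> \<O> u" using u(2) by (simp add: refinement_of_def)
    have tu: "t \<in> \<O> u" "inverse t \<in> \<O> u" and cu: "c \<in> \<O> u" "inverse c \<in> \<O> u"
      using u by (auto simp: val_units_iff)
    have "?s / t * t \<in> \<O> u" using bound[OF u(1)] sub tu by (intro val_ring_mult) auto
    moreover have "z \<in> \<O> u"
    proof -
      have "z / c ^ d * c ^ d \<in> \<O> u \<or> z / inverse c ^ d * inverse c ^ d \<in> \<O> u"
        using z(2)[OF u(1)] sub cu by (meson val_ring_mult val_ring_power subsetD)
      then show ?thesis using c by auto
    qed
    then have "inverse t * (inverse t * z) \<in> \<O> u" using tu by (intro val_ring_mult)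
    ultimately show ?thesis using t_nonzero z(1) by (simp add: val_units_iff field_simps)
  qed
  then show ?thesis using that[of ?s] bound t_nonzero z(1) by simp
qed

section \<open>Prescribed values\<close>

text \<open>The values c and 1 represent two arbitrary prescribed values after division by the
  second. An approximate idempotent e, near 1 on S1 and near 0 on S2, gives
  \<open>c * e + (1 - e)\<close>; the nearness must also hold relative to c.\<close>

lemma two_set_values:
  assumes S1: "compactin zar_star_topology S1" "S1 \<subseteq> S"
    and S2: "compactin zar_star_topology S2" "S2 \<subseteq> S"
    and ind: "independent_sets t S1 S2" "incomparable_sets S1 S2"
    and c: "c \<noteq> 0" "independent_sets c S1 S2"
  obtains z where "z \<noteq> 0" "\<And>v. v \<in> S1 \<Longrightarrow> val_eq v z c" "\<And>v. v \<in> S2 \<Longrightarrow> val_eq v z 1"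
proof (cases "S1 = {} \<or> S2 = {}")
  case True
  have "val_eq v x x" for v and x :: 'a by (simp add: val_eq_iff val_ring_one)
  then show ?thesis using True that[of c] that[of 1] c by auto
next
  case False
  obtain s where s: "s \<noteq> 0" "\<And>v. v \<in> S \<Longrightarrow> s / t \<in> \<O> v"
    "\<And>v. v \<in> S \<Longrightarrow> s / t * c \<in> \<O> v" "\<And>v. v \<in> S \<Longrightarrow> s / t / c \<in> \<O> v"
    "\<And>v u. v \<in> S \<Longrightarrow> refinement_of v u \<Longrightarrow> t \<in> val_units u \<Longrightarrow> c \<in> val_units u \<Longrightarrow> s \<in> val_units u"
    using bounding_element[OF c(1)] by metis
  have s_ring: "s \<in> \<O> v" if "v \<in> S" for v
    using val_ring_mult[OF s(2) t_in_val_ring] that t_nonzero by simp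
  have "independent_sets s S1 S2"
    using ind c(2) s(5) S1(2) val_join_coarsening(1) unfolding independent_sets_def by blast
  then obtain y where y: "y \<noteq> 0" "\<And>v. v \<in> S1 \<Longrightarrow> 1 / (y * s) \<in> \<mm> v" "\<And>v. v \<in> S2 \<Longrightarrow> y / s \<in> \<mm> v"
    using separation[OF S1(1) _ S1(2) S2(1) _ S2(2) s(1)] s(2) s_ring False ind(2) by metis
  define e where "e = coeff f d * y ^ d / poly f y"
  have near_one: "1 - e \<in> \<mm> v" "(1 - e) / c \<in> \<mm> v" if v: "v \<in> S1" for v
  proof -
    have vS: "v \<in> S" using v S1 by blast
    have "1 / (y * s) * s \<in> \<mm> v" using y(2) v s_ring vS by (intro val_ideal_mult)
    then have y_neg: "y \<notin> \<O> v" using y(1) s(1) by (simp add: val_ideal_iff inverse_eq_divide)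
    have d: "y ^ d = y ^ (d - 1) * y" using degree_ge by (cases d) auto
    let ?q = "(poly f y - coeff f d * y ^ d) / y ^ (d - 1) * (t * y ^ d / poly f y)"
    have q: "?q \<in> \<O> v" using vS y_neg by (intro val_ring_mult poly_neg)
    \<comment> \<open>By (iii), f(y) differs from its leading term by an integral multiple of
      y^(d-1), so 1 - e is ?q / (y t). The factor s pays for 1/t here and for 1/(t c) below.\<close>
    have eq: "1 / (y * s) * (?q * (s / t)) = 1 - e"
      using poly_neg(2)[OF vS y_neg] y(1) s(1) t_nonzero
      unfolding e_def by (simp add: d field_simps)
    have mem: "1 / (y * s) * (?q * r) \<in> \<mm> v" if "r \<in> \<O> v" for r
      using val_ideal_mult[OF y(2)[OF v] val_ring_mult[OF q that]] .
    show "1 - e \<in> \<mm> v" using mem[OF s(2)[OF vS]] unfolding eq .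
    have "1 / (y * s) * (?q * (s / t / c)) = (1 - e) / c" unfolding eq[symmetric] by simp
    then show "(1 - e) / c \<in> \<mm> v" using mem[OF s(4)[OF vS]] by simp
  qed
  have near_zero: "e \<in> \<mm> v" "e * c \<in> \<mm> v" if v: "v \<in> S2" for v
  proof -
    have vS: "v \<in> S" using v S2 by blast
    have "y / s * s \<in> \<mm> v" using y(3) v s_ring vS by (intro val_ideal_mult)
    then have y_pos: "y \<in> \<mm> v" using s(1) by simp
    \<comment> \<open>The inverse of y is the nonintegral element that makes the leading coefficient
      integral.\<close>
    then have "inverse y \<notin> \<O> v" using y(1) by (simp add: val_ideal_iff)
    then have lead: "coeff f d \<in> \<O> v" using lead_coeff_in_val_ring vS by blast
    have y_ring: "y \<in> \<O> v" using y_pos by (rule val_ideal_subset)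
    let ?q = "coeff f d * y ^ (d - 1) * (t / poly f y)"
    have q: "?q \<in> \<O> v"
      using lead y_ring vS by (intro val_ring_mult val_ring_power poly_nonneg)
    have d: "y ^ d = y ^ (d - 1) * y" using degree_ge by (cases d) auto
    have eq: "y / s * (?q * (s / t)) = e"
      using poly_nonneg(2)[OF vS y_ring] y(1) s(1) t_nonzero
      unfolding e_def by (simp add: d field_simps)
    have mem: "y / s * (?q * r) \<in> \<mm> v" if "r \<in> \<O> v" for r
      using val_ideal_mult[OF y(3)[OF v] val_ring_mult[OF q that]] .
    show "e \<in> \<mm> v" using mem[OF s(2)[OF vS]] unfolding eq .
    have "y / s * (?q * (s / t * c)) = e * c" unfolding eq[symmetric] by simp
    then show "e * c \<in> \<mm> v" using mem[OF s(3)[OF vS]] by simp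
  qed
  let ?z = "c * e + (1 - e)"
  have z1: "val_eq v ?z c" if "v \<in> S1" for v
  proof -
    have "?z / c = 1 + ((1 - e) / c - (1 - e))" using c(1) by (simp add: field_simps)
    then have "?z / c \<in> val_units v"
      using one_add_val_ideal_unit[OF val_ideal_diff[OF near_one(2,1)[OF that]]] by simp
    then show ?thesis by (rule val_eq_if_unit)
  qed
  have z2: "val_eq v ?z 1" if "v \<in> S2" for v
  proof -
    have "?z / 1 = 1 + (e * c - e)" by (simp add: field_simps)
    then have "?z / 1 \<in> val_units v"
      using one_add_val_ideal_unit[OF val_ideal_diff[OF near_zero(2,1)[OF that]]] by metis
    then show ?thesis by (rule val_eq_if_unit)
  qed
  \<comment> \<open>S2 is nonempty here, and 0 does not have the value of 1.\<close>
  have "?z \<noteq> 0" using False z2 by (force simp: val_eq_iff)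
  then show ?thesis using that z1 z2 by blast
qed

lemma finite_family_values:
  assumes "finite J" and nz: "\<And>i. i \<in> J \<Longrightarrow> zz i \<noteq> 0"
    and T: "\<And>i. i \<in> J \<Longrightarrow> compactin zar_star_topology (V i) \<and> V i \<subseteq> S"
    and I: "\<And>i j. i \<in> J \<Longrightarrow> j \<in> J \<Longrightarrow> i \<noteq> j \<Longrightarrow>
              independent_sets t (V i) (V j) \<and> incomparable_sets (V i) (V j)"
    and compat: "\<And>i j v v'. i \<in> J \<Longrightarrow> j \<in> J \<Longrightarrow> v \<in> V i \<Longrightarrow> v' \<in> V j \<Longrightarrow>
              val_eq (val_join v v') (zz i) (zz j)"
  shows "\<exists>z. z \<noteq> 0 \<and> (\<forall>i\<in>J. \<forall>v\<in>V i. val_eq v z (zz i))"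
  using assms
proof (induction J)
  case empty
  then show ?case by (intro exI[of _ 1]) simp
next
  case (insert a J)
  have "\<exists>z. z \<noteq> 0 \<and> (\<forall>i\<in>J. \<forall>v\<in>V i. val_eq v z (zz i))"
    using insert.prems by (intro insert.IH) simp_all
  then obtain z where z: "z \<noteq> 0" "\<And>i v. i \<in> J \<Longrightarrow> v \<in> V i \<Longrightarrow> val_eq v z (zz i)"
    by blast
  let ?S1 = "\<Union>i\<in>J. V i"
  have za: "zz a \<noteq> 0" using insert.prems(1) by simp
  have C: "compactin zar_star_topology ?S1" "?S1 \<subseteq> S"
    "compactin zar_star_topology (V a)" "V a \<subseteq> S"
    using insert.prems(2) insert.hyps(1) by (auto intro!: compactin_Union)
  have ind: "independent_sets t ?S1 (V a)" "incomparable_sets ?S1 (V a)"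
    using insert.prems(3) insert.hyps(2)
    unfolding independent_sets_def incomparable_sets_def by (metis UN_E insertCI)+
  \<comment> \<open>Compatibility survives the induction step: z agrees with some
    \<open>zz i\<close> at v, hence at the coarser join, where \<open>zz i\<close> agrees with
    \<open>zz a\<close>.\<close>
  have "independent_sets (z / zz a) ?S1 (V a)"
    unfolding independent_sets_def
  proof (intro ballI)
    fix v w assume "v \<in> ?S1" "w \<in> V a"
    then obtain i where i: "i \<in> J" "v \<in> V i" by blast
    have "val_eq (val_join v w) z (zz i)"
      using val_eq_coarsening[OF z(2)[OF i] val_join_coarsening(1)] .
    moreover have "val_eq (val_join v w) (zz i) (zz a)"
      using insert.prems(4) i \<open>w \<in> V a\<close> by blast
    ultimately have "val_eq (val_join v w) z (zz a)" by (rule val_eq_trans)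
    then show "z / zz a \<in> val_units (val_join v w)"
      using z(1) za by (simp add: val_eq_iff val_units_iff)
  qed
  from two_set_values[OF C ind _ this] z(1) za obtain x where x: "x \<noteq> 0"
    "\<And>v. v \<in> ?S1 \<Longrightarrow> val_eq v x (z / zz a)" "\<And>v. v \<in> V a \<Longrightarrow> val_eq v x 1"
    by auto
  \<comment> \<open>Multiplying by \<open>zz a\<close> undoes the normalization to the value of 1 on
    \<open>V a\<close>.\<close>
  have scale: "val_eq v (x * zz a) (b * zz a)" if "val_eq v x b" for v b
    using that za by (auto simp: val_eq_iff split: if_splits)
  have "val_eq v (x * zz a) (zz i)" if "i \<in> insert a J" "v \<in> V i" for i v
  proof (cases "i = a")
    case True then show ?thesis using scale[OF x(3)] that by simp
  next
    case False
    then have "i \<in> J" using that by blast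
    then have "val_eq v (x * zz a) z" using scale[OF x(2)] that za by fastforce
    then show ?thesis using z(2)[OF \<open>i \<in> J\<close> that(2)] by (rule val_eq_trans)
  qed
  then show ?case using x(1) za by (intro exI[of _ "x * zz a"]) simp
qed

end

theorem corollary5p1:
  fixes n :: nat and S :: "nat \<Rightarrow> 'a::field S_val set" and t :: 'a and zz :: "nat \<Rightarrow> 'a"
  assumes "t \<noteq> 0"
    and "\<And>i. i \<in> {1..n} \<Longrightarrow> zz i \<noteq> 0"
    and U: "uniformity_assumption (\<Union>i\<in>{1..n}. S i) t"
    and T: "\<And>i. i \<in> {1..n} \<Longrightarrow> compactin zar_star_topology (S i)"
    and I: "\<And>i j. i \<in> {1..n} \<Longrightarrow> j \<in> {1..n} \<Longrightarrow> i \<noteq> j \<Longrightarrow>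
              independent_sets t (S i) (S j) \<and> incomparable_sets (S i) (S j)"
  shows "(\<exists>z. z \<noteq> 0 \<and> (\<forall>i\<in>{1..n}. \<forall>v\<in>S i. val_eq v z (zz i))) \<longleftrightarrow>
    (\<forall>i\<in>{1..n}. \<forall>j\<in>{1..n}. \<forall>w. (\<exists>v\<in>S i. refinement_of v w) \<and> (\<exists>v\<in>S j. refinement_of v w) \<longrightarrow>
       val_eq w (zz i) (zz j))" (is "?lhs \<longleftrightarrow> ?rhs")
proof
  assume ?lhs
  \<comment> \<open>Agreement of z with \<open>zz i\<close> and with \<open>zz j\<close> passes from
    the two refinements to w.\<close>
  then show ?rhs by (meson val_eq_coarsening val_eq_sym val_eq_trans)
next
  assume compat: ?rhs
  obtain f d where f: "d \<ge> 2" "\<forall>v\<in>(\<Union>i\<in>{1..n}. S i).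
      (\<forall>x\<in>\<O> v. poly f x \<in> \<O> v) \<and> (\<forall>x\<in>\<O> v. poly f x \<notin> (*) t ` \<mm> v) \<and>
      (\<forall>x. x \<notin> \<O> v \<longrightarrow>
        poly f x \<in> (\<lambda>y. x ^ d * y) ` (\<O> v - (*) t ` \<mm> v) \<inter>
          (\<lambda>y. coeff f d * x ^ d + x ^ (d - 1) * y) ` \<O> v)"
  proof -
    have weaken: "(\<forall>v\<in>A. P v \<and> Q v \<and> R v \<and> Z v) \<Longrightarrow> (\<forall>v\<in>A. P v \<and> Q v \<and> R v)"
      for A :: "'a S_val set" and P Q R Z by blast
    show ?thesis using U unfolding uniformity_assumption_def
      by (elim exE conjE) (rule that, assumption, erule weaken)
  qed
  have "uniform_valuations (\<Union>i\<in>{1..n}. S i) t f d"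
    by (rule uniform_valuations.intro) (use f \<open>t \<noteq> 0\<close> in blast)+
  then interpret uniform_valuations "\<Union>i\<in>{1..n}. S i" t f d .
  show ?lhs
  proof (rule finite_family_values)
    fix i j v v' assume "i \<in> {1..n}" "j \<in> {1..n}" "v \<in> S i" "v' \<in> S j"
    \<comment> \<open>The join is itself a valuation w with the refinements v in \<open>S i\<close>
      and v' in \<open>S j\<close>.\<close>
    then show "val_eq (val_join v v') (zz i) (zz j)"
      using compat val_join_coarsening(1,2) by blast
  qed (use assms in auto)
qed

end
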